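(* For any natural numbers $k$ and $p$, the class of $N(p)$-free bipartite graphs of chordality at most $k$ is at most factorial.
   Context: Graphs are finite, simple and undirected. Every bipartite graph is given together with a bipartition of its vertex set into two independent sets (parts). A bipartite graph $G$ contains a bipartite graph $H$ as an induced subgraph if there is an induced copy of $H$ in $G$ in which the two parts of $H$ are mapped into the two different parts of $G$ (it is not specified which part of $H$ goes to which part of $G$); otherwise $G$ is $H$-free. A bipartite graph has chordality at most $k$ if it has no chordless (induced) cycle of length greater than $k$. $L(1,p)$ is the bipartite graph obtained from $K_{2,p}$ by adding one pendant edge to one of the two vertices of the part of size $2$ (a vertex of degree $p$ in $K_{2,p}$); its parts have sizes $2$ and $p+1$. $N(p)=L(1,p)+O_{1,0}$ is obtained from $L(1,p)$ by adding one isolated vertex to the smaller part (the part of size $2$). A hereditary class (one closed under taking induced subgraphs) is at most factorial if the number of labelled graphs in it with vertex set $\{1,\ldots,n\}$ is $2^{O(n\log n)}$. *)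

theory Defs
  imports Complex_Main "HOL-Library.Landau_Symbols"
begin

text \<open>
  A bipartite graph carries its bipartition. Edges are two-element sets of vertices; the parts may
  be empty.
\<close>

record 'a bigraph =
  left :: "'a set"
  right :: "'a set"
  edges :: "'a set set"

definition verts :: "'a bigraph \<Rightarrow> 'a set" where
  "verts G = left G \<union> right G"

definition adj :: "'a bigraph \<Rightarrow> 'a \<Rightarrow> 'a \<Rightarrow> bool" where
  "adj G x y \<longleftrightarrow> {x, y} \<in> edges G"

definition bipartite_graph :: "'a bigraph \<Rightarrow> bool" where
  "bipartite_graph G \<longleftrightarrow>
     finite (left G) \<and> finite (right G) \<and> left G \<inter> right G = {} \<and>
     edges G \<subseteq> {{x, y} | x y. x \<in> left G \<and> y \<in> right G}"

text \<open>
  An induced copy of \<open>H\<close> in \<open>G\<close> sends the two parts of \<open>H\<close> into different parts of \<open>G\<close>, in either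
  order.
\<close>

definition contains_induced :: "'a bigraph \<Rightarrow> 'b bigraph \<Rightarrow> bool" where
  "contains_induced G H \<longleftrightarrow>
     (\<exists>f. inj_on f (verts H) \<and>
          (\<forall>x\<in>verts H. \<forall>y\<in>verts H. adj G (f x) (f y) \<longleftrightarrow> adj H x y) \<and>
          (f ` left H \<subseteq> left G \<and> f ` right H \<subseteq> right G \<or>
           f ` left H \<subseteq> right G \<and> f ` right H \<subseteq> left G))"

definition is_cycle :: "'a bigraph \<Rightarrow> 'a list \<Rightarrow> bool" where
  "is_cycle G xs \<longleftrightarrow>
     3 \<le> length xs \<and> distinct xs \<and> set xs \<subseteq> verts G \<and>
     (\<forall>i<length xs. adj G (xs ! i) (xs ! (Suc i mod length xs)))"

definition chordless :: "'a bigraph \<Rightarrow> 'a list \<Rightarrow> bool" where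
  "chordless G xs \<longleftrightarrow>
     (\<forall>i<length xs. \<forall>j<length xs. adj G (xs ! i) (xs ! j) \<longrightarrow>
        j = Suc i mod length xs \<or> i = Suc j mod length xs)"

definition chordality_at_most :: "nat \<Rightarrow> 'a bigraph \<Rightarrow> bool" where
  "chordality_at_most k G \<longleftrightarrow>
     \<not> (\<exists>xs. is_cycle G xs \<and> chordless G xs \<and> k < length xs)"

definition complete_bipartite :: "nat \<Rightarrow> nat \<Rightarrow> nat bigraph" where
  "complete_bipartite m n =
     \<lparr>left = {0..<m}, right = {m..<m + n},
      edges = {{x, y} | x y. x \<in> {0..<m} \<and> y \<in> {m..<m + n}}\<rparr>"

text \<open>
  \<open>K\<^bsub>2,p\<^esub>\<close> has parts \<open>{0, 1}\<close> and \<open>{2, \<dots>, p + 1}\<close>; the pendant edge joins \<open>0\<close> to the new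
  vertex \<open>p + 2\<close>, and \<open>p + 3\<close> is the isolated vertex added to the part \<open>{0, 1}\<close>.
\<close>

definition L1 :: "nat \<Rightarrow> nat bigraph" where
  "L1 p = (let K = complete_bipartite 2 p in
     \<lparr>left = left K, right = insert (p + 2) (right K), edges = insert {0, p + 2} (edges K)\<rparr>)"

definition N :: "nat \<Rightarrow> nat bigraph" where
  "N p = (L1 p)\<lparr>left := insert (p + 3) (left (L1 p))\<rparr>"

text \<open>
  Classes are sets of graphs whose vertices are natural numbers. Since \<^const>\<open>contains_induced\<close> is up
  to isomorphism, a hereditary class is in particular closed under isomorphism.
\<close>

definition hereditary :: "nat bigraph set \<Rightarrow> bool" where
  "hereditary X \<longleftrightarrow>
     (\<forall>G\<in>X. bipartite_graph G) \<and>
     (\<forall>G\<in>X. \<forall>H. bipartite_graph H \<and> contains_induced G H \<longrightarrow> H \<in> X)"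

definition labelled :: "nat bigraph set \<Rightarrow> nat \<Rightarrow> nat bigraph set" where
  "labelled X n = {G \<in> X. verts G = {1..n}}"

text \<open>
  Labelled graphs are counted together with their ordered bipartition, which bounds the number of
  underlying labelled graphs from above (and exceeds it by a factor of at most \<open>2 ^ n\<close>).
\<close>

definition at_most_factorial :: "nat bigraph set \<Rightarrow> bool" where
  "at_most_factorial X \<longleftrightarrow>
     hereditary X \<and>
     (\<exists>f :: nat \<Rightarrow> real. f \<in> O(\<lambda>n. real n * ln (real n)) \<and>
        (\<forall>n. real (card (labelled X n)) \<le> 2 powr f n))"

text \<open>The cardinality above is that of a finite set.\<close>

lemma finite_labelled:
  assumes "\<forall>G\<in>X. bipartite_graph G"
  shows "finite (labelled X n)"
proof (rule finite_subset)
  let ?P = "Pow {1..n}"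
  let ?g = "\<lambda>(A, B, E). \<lparr>left = A, right = B, edges = E\<rparr> :: nat bigraph"
  show "labelled X n \<subseteq> ?g ` (?P \<times> ?P \<times> Pow ?P)"
  proof
    fix G assume G: "G \<in> labelled X n"
    then have "bipartite_graph G" "left G \<union> right G = {1..n}"
      using assms by (auto simp: labelled_def verts_def)
    then have "(left G, right G, edges G) \<in> ?P \<times> ?P \<times> Pow ?P"
      unfolding bipartite_graph_def by fastforce
    moreover have "G = ?g (left G, right G, edges G)" by simp
    ultimately show "G \<in> ?g ` (?P \<times> ?P \<times> Pow ?P)" by blast
  qed
qed simp

end

theory Submission
  imports Defs "HOL-Library.FuncSet" "HOL-Real_Asymp.Real_Asymp"
begin

text \<open>
  Write \<open>N(x)\<close> for the neighbourhood of \<open>x\<close>. Three vertices \<open>r\<close>, \<open>u\<close>, \<open>v\<close> of one part such that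
  \<open>N(r) \<inter> N(u) - N(v)\<close> has at least \<open>p\<close> elements and \<open>N(r) - N(u) - N(v)\<close> is nonempty span a copy
  of \<open>N(p)\<close>, with \<open>v\<close> as the isolated vertex. So in an \<open>N(p)\<close>-free graph \<open>N(r) - N(u) \<subseteq> N(v)\<close> as
  soon as \<open>N(r) \<inter> N(u) - N(v)\<close> is large, for both parts; this is all that is used of
  \<open>N(p)\<close>-freeness. The threshold is \<open>q = p + 1\<close>, which is positive also when \<open>p = 0\<close>.

  The condition makes a graph with parts \<open>A\<close> and \<open>B\<close> nearly trivial apart from a sparse remainder.
  Fix \<open>r \<in> A\<close> and put \<open>S(v) = N(r) - N(v)\<close>. Outside \<open>N(r)\<close>, two vertices of \<open>A\<close> have the same
  neighbours or fewer than \<open>q\<close> common ones. Inside \<open>N(r)\<close>, the condition for \<open>r\<close>, \<open>u\<close>, \<open>v\<close> says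
  that \<open>S(u)\<close> and \<open>S(v)\<close> are disjoint or \<open>S(v) - S(u)\<close> has fewer than \<open>q\<close> elements. Take a maximal
  family \<open>M\<close> of vertices whose sets \<open>S(u)\<close> are large and pairwise disjoint. Every \<open>v\<close> is then joined
  to all of \<open>N(r)\<close> except fewer than \<open>q\<close> vertices and except part of a single \<open>S(u)\<close> with
  \<open>u \<in> M\<close>. What happens inside the sets \<open>S(u)\<close> is a disjoint union of graphs that lie outside
  \<open>N(u)\<close>, so again two vertices of \<open>A\<close> are twins or have few common neighbours there
  (\<open>triple_condition_decomposition\<close>). The same holds with the parts exchanged. Superposing both
  decompositions, the graph is described by \<open>O(n)\<close> vertex names together with four graphs in which
  any two vertices of the same part, whichever part it is, are twins or have fewer than \<open>q\<close> common
  neighbours (\<open>card_triple_class\<close>).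

  Such a graph without holes longer than \<open>k\<close> can be dismantled one vertex at a time. If no two
  vertices are twins, let \<open>x\<close> be the end of a longest induced path. Each neighbour \<open>y\<close> of \<open>x\<close> off
  the path sends a second edge to the path, since otherwise the path could be prolonged by \<open>y\<close>. The
  first such edge closes a hole, so it ends at one of the first \<open>k\<close> vertices of the path. That
  vertex lies in the part of \<open>x\<close> and shares fewer than \<open>q\<close> neighbours with \<open>x\<close>; hence the degree of
  \<open>x\<close> is bounded (\<open>low_degree_or_twins\<close>). Removing a vertex of bounded degree or a twin costs
  \<open>O(log n)\<close> bits (\<open>card_two_sided\<close>), which gives \<open>2 ^ O(n log n)\<close> graphs in total.
\<close>

section \<open>Bipartite edge sets and their block subgraphs\<close>

text \<open>
  The parts are fixed throughout the counting, so a graph is given by its set of two-element edges.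
  This representation is symmetric in the two parts.
\<close>

definition between :: "'a set \<Rightarrow> 'a set \<Rightarrow> 'a set set" where
  "between A B = {{x, y} | x y. x \<in> A \<and> y \<in> B}"

definition nbs :: "'a set set \<Rightarrow> 'a \<Rightarrow> 'a set" where
  "nbs E x = {y. {x, y} \<in> E}"

text \<open>
  The equivalence expresses at once that consecutive vertices are adjacent and that there is no chord.
\<close>

definition hole :: "'a set set \<Rightarrow> 'a list \<Rightarrow> bool" where
  "hole E xs \<longleftrightarrow> 3 \<le> length xs \<and> distinct xs \<and>
     (\<forall>i<length xs. \<forall>j<length xs. {xs ! i, xs ! j} \<in> E \<longleftrightarrow>
        j = Suc i mod length xs \<or> i = Suc j mod length xs)"

definition holes_at_most :: "nat \<Rightarrow> 'a set set \<Rightarrow> bool" where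
  "holes_at_most k E \<longleftrightarrow> (\<forall>xs. hole E xs \<longrightarrow> length xs \<le> k)"

definition nearly_disjoint_or_twins :: "nat \<Rightarrow> 'a set \<Rightarrow> 'a set set \<Rightarrow> bool" where
  "nearly_disjoint_or_twins q A E \<longleftrightarrow>
     (\<forall>a\<in>A. \<forall>a'\<in>A. nbs E a = nbs E a' \<or> card (nbs E a \<inter> nbs E a') < q)"

definition triple_condition :: "nat \<Rightarrow> 'a set \<Rightarrow> 'a set set \<Rightarrow> bool" where
  "triple_condition q A E \<longleftrightarrow>
     (\<forall>r\<in>A. \<forall>u\<in>A. \<forall>v\<in>A. q \<le> card (nbs E r \<inter> nbs E u - nbs E v) \<longrightarrow>
        nbs E r - nbs E u \<subseteq> nbs E v)"

text \<open>
  The disjoint union of the subgraphs induced by the label classes; vertices labelled \<^const>\<open>None\<close>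
  become isolated. Induced subgraphs are the case of a single label.
\<close>

definition blocks :: "('a \<Rightarrow> 'b option) \<Rightarrow> 'a set set \<Rightarrow> 'a set set" where
  "blocks l E = {e \<in> E. \<exists>c. \<forall>x\<in>e. l x = Some c}"

lemma mem_nbs [simp]: "y \<in> nbs E x \<longleftrightarrow> {x, y} \<in> E"
  by (simp add: nbs_def)

lemma between_commute: "between A B = between B A"
  unfolding between_def by (metis (no_types, opaque_lifting) insert_commute)

lemma edge_between:
  assumes "{x, y} \<in> E" "E \<subseteq> between A B"
  shows "x \<in> A \<and> y \<in> B \<or> x \<in> B \<and> y \<in> A"
  using assms unfolding between_def by (fastforce simp: doubleton_eq_iff)

lemma nbs_subset:
  assumes "E \<subseteq> between A B" "A \<inter> B = {}" "a \<in> A"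
  shows "nbs E a \<subseteq> B"
  using edge_between[OF _ assms(1)] assms(2,3) by fastforce

lemma finite_nbs:
  assumes "E \<subseteq> between A B" "finite A" "finite B"
  shows "finite (nbs E x)"
proof (rule finite_subset)
  show "nbs E x \<subseteq> A \<union> B"
    using edge_between[OF _ assms(1)] by (metis UnI1 UnI2 mem_nbs subsetI)
qed (use assms in simp)

lemma blocks_edge: "{x, y} \<in> blocks l E \<longleftrightarrow> {x, y} \<in> E \<and> (\<exists>c. l x = Some c \<and> l y = Some c)"
  by (auto simp: blocks_def)

lemma blocks_subset: "blocks l E \<subseteq> E"
  by (auto simp: blocks_def)

lemma blocks_commute: "blocks l (blocks m E) = blocks m (blocks l E)"
  by (auto simp: blocks_def)

text \<open>
  A hole is connected, so it stays within one label class, where \<^const>\<open>blocks\<close> keeps every chord.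
\<close>

lemma holes_at_most_blocks:
  assumes "holes_at_most k E"
  shows "holes_at_most k (blocks l E)"
  unfolding holes_at_most_def
proof (intro allI impI)
  fix xs assume h: "hole (blocks l E) xs"
  define n where "n = length xs"
  have n: "3 \<le> n" and d: "distinct xs"
    and adj: "\<And>i j. i < n \<Longrightarrow> j < n \<Longrightarrow> {xs ! i, xs ! j} \<in> blocks l E \<longleftrightarrow>
        j = Suc i mod n \<or> i = Suc j mod n"
    using h unfolding hole_def n_def by auto
  have same: "i < n \<Longrightarrow> \<exists>c. l (xs ! i) = Some c \<and> l (xs ! 0) = Some c" for i
  proof (induction i)
    case 0
    have "{xs ! 0, xs ! 1} \<in> blocks l E" using adj[of 0 1] n by simp
    then show ?case by (auto simp: blocks_edge)
  next
    case (Suc i)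
    have "{xs ! i, xs ! Suc i} \<in> blocks l E" using adj[of i "Suc i"] Suc.prems by simp
    then show ?case using Suc by (auto simp: blocks_edge)
  qed
  have "{xs ! i, xs ! j} \<in> E \<longleftrightarrow> {xs ! i, xs ! j} \<in> blocks l E" if "i < n" "j < n" for i j
    using same[OF that(1)] same[OF that(2)] by (auto simp: blocks_edge)
  then have "hole E xs"
    unfolding hole_def using n d adj by (simp add: n_def)
  then show "length xs \<le> k" using assms by (simp add: holes_at_most_def)
qed

text \<open>
  Vertices with the same label lose the same neighbours. Vertices with different labels have no
  common neighbour left, and \<open>0 < q\<close>.
\<close>

lemma nearly_disjoint_or_twins_blocks:
  assumes "nearly_disjoint_or_twins q A E" "0 < q"
    and "\<And>a. a \<in> A \<Longrightarrow> finite (nbs E a)"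
  shows "nearly_disjoint_or_twins q A (blocks l E)"
  unfolding nearly_disjoint_or_twins_def
proof (intro ballI)
  fix a a' assume a: "a \<in> A" "a' \<in> A"
  let ?N = "nbs (blocks l E)"
  show "?N a = ?N a' \<or> card (?N a \<inter> ?N a') < q"
  proof (cases "l a = l a'")
    case True
    have "nbs E a = nbs E a' \<or> card (nbs E a \<inter> nbs E a') < q"
      using assms(1) a by (auto simp: nearly_disjoint_or_twins_def)
    then show ?thesis
    proof
      assume eq: "nbs E a = nbs E a'"
      have "{a, y} \<in> E \<longleftrightarrow> {a', y} \<in> E" for y using eq by (auto simp: set_eq_iff)
      then have "?N a = ?N a'" using True by (auto simp: blocks_edge)
      then show ?thesis ..
    next
      assume *: "card (nbs E a \<inter> nbs E a') < q"
      have "?N a \<inter> ?N a' \<subseteq> nbs E a \<inter> nbs E a'" by (auto simp: blocks_edge)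
      then have "card (?N a \<inter> ?N a') \<le> card (nbs E a \<inter> nbs E a')"
        using assms(3)[OF a(1)] by (intro card_mono) auto
      then show ?thesis using * by simp
    qed
  next
    case False
    then have "?N a \<inter> ?N a' = {}" by (auto simp: blocks_edge)
    then show ?thesis using assms(2) by simp
  qed
qed

section \<open>Decomposition relative to one part\<close>

text \<open>
  The labelling \<open>l\<close> separates off the part of \<open>B\<close> outside \<open>N(r)\<close>. The labelling \<open>m\<close> gives each
  vertex of a set \<open>S(u)\<close>, \<open>u \<in> M\<close>, the label \<open>u\<close>, and gives \<open>v \<in> A\<close> the label \<open>u\<close> of a set \<open>S(u)\<close>
  that meets \<open>S(v)\<close>. Every pair that neither labelling joins is an edge unless \<open>X\<close> lists it as an
  exception.
\<close>

lemma triple_condition_decomposition: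
  fixes A B :: "'a set"
  assumes fin: "finite A" "finite B" and dis: "A \<inter> B = {}"
    and E: "E \<subseteq> between A B" and trip: "triple_condition q A E" and q: "0 < q"
  obtains l m :: "'a \<Rightarrow> 'a option" and X :: "'a \<Rightarrow> 'a set"
  where "range l \<subseteq> insert None (Some ` A)" "range m \<subseteq> insert None (Some ` A)"
    "nearly_disjoint_or_twins q A (blocks l E)" "nearly_disjoint_or_twins q A (blocks m E)"
    "\<forall>a\<in>A. X a \<subseteq> B \<and> card (X a) < q"
    "\<forall>a\<in>A. \<forall>b\<in>B. \<not> (\<exists>c. l a = Some c \<and> l b = Some c) \<longrightarrow>
       \<not> (\<exists>c. m a = Some c \<and> m b = Some c) \<longrightarrow> ({a, b} \<in> E \<longleftrightarrow> b \<notin> X a)"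
proof (cases "A = {}")
  case True
  show ?thesis
    by (rule that[of "\<lambda>_. None" "\<lambda>_. None" "\<lambda>_. {}"])
      (use True in \<open>auto simp: nearly_disjoint_or_twins_def\<close>)
next
  case False
  then obtain r where r: "r \<in> A" by auto
  have nB: "nbs E a \<subseteq> B" if "a \<in> A" for a using nbs_subset[OF E dis that] .
  have nfin: "finite (nbs E a)" if "a \<in> A" for a using nB[OF that] fin(2) finite_subset by blast
  have twins_outside: "nbs E a - nbs E v = nbs E a' - nbs E v"
    if "a \<in> A" "a' \<in> A" "v \<in> A" "q \<le> card (nbs E a \<inter> nbs E a' - nbs E v)" for a a' v
  proof -
    have "nbs E a - nbs E a' \<subseteq> nbs E v"
      using trip that unfolding triple_condition_def by blast
    moreover have "nbs E a' - nbs E a \<subseteq> nbs E v"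
      using trip that unfolding triple_condition_def by (metis Int_commute)
    ultimately show ?thesis by blast
  qed
  define S where "S v = nbs E r - nbs E v" for v
  have Sfin: "finite (S v)" for v using nfin[OF r] by (simp add: S_def)
  have SB: "S v \<subseteq> B" for v using nB[OF r] by (auto simp: S_def)
  have meet: "card (S v - S u) < q" if "u \<in> A" "v \<in> A" "S v \<inter> S u \<noteq> {}" for u v
  proof (rule ccontr)
    assume "\<not> ?thesis"
    moreover have "S v - S u = nbs E r \<inter> nbs E u - nbs E v" by (auto simp: S_def)
    ultimately have "nbs E r - nbs E u \<subseteq> nbs E v"
      using trip r that(1,2) unfolding triple_condition_def by simp
    then show False using that(3) by (auto simp: S_def)
  qed
  \<comment> \<open>Sets of size below \<open>q\<close> are left out of the family: they fit into the exceptions.\<close>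
  define good where "good M \<longleftrightarrow> M \<subseteq> A \<and> (\<forall>u\<in>M. q \<le> card (S u)) \<and>
      (\<forall>u\<in>M. \<forall>v\<in>M. u \<noteq> v \<longrightarrow> S u \<inter> S v = {})" for M
  have "finite {M. good M}"
    by (rule finite_subset[of _ "Pow A"]) (auto simp: good_def fin)
  moreover have "good {}" by (simp add: good_def)
  ultimately obtain M where M: "good M" and max: "\<And>M'. good M' \<Longrightarrow> M \<subseteq> M' \<Longrightarrow> M' = M"
    using finite_has_maximal[of "{M. good M}"] by auto
  have MA: "M \<subseteq> A" using M by (simp add: good_def)
  have covers: "\<exists>u\<in>M. S v \<inter> S u \<noteq> {}" if v: "v \<in> A" "q \<le> card (S v)" for v
  proof (rule ccontr)
    assume no: "\<not> ?thesis"
    have "good (insert v M)" using M no v unfolding good_def by blast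
    then have "v \<in> M" using max[of "insert v M"] by blast
    moreover have "S v \<noteq> {}" using v(2) q by auto
    ultimately show False using no by blast
  qed
  \<comment> \<open>The choice is forced for a singleton, as the sets \<open>S u\<close> with \<open>u \<in> M\<close> are disjoint; so \<open>own\<close>
    serves both the vertices of \<open>B\<close> and, applied to \<open>S v\<close>, those of \<open>A\<close>.\<close>
  define own where "own T = (if \<exists>u\<in>M. T \<inter> S u \<noteq> {} then Some (SOME u. u \<in> M \<and> T \<inter> S u \<noteq> {}) else None)" for T
  have own_Some: "u \<in> M \<and> T \<inter> S u \<noteq> {}" if "own T = Some u" for T u
  proof -
    have ex: "\<exists>u. u \<in> M \<and> T \<inter> S u \<noteq> {}" using that by (auto simp: own_def split: if_splits)
    then show ?thesis using someI_ex[OF ex] that by (auto simp: own_def split: if_splits)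
  qed
  have own_point: "own {b} = Some u" if "u \<in> M" "b \<in> S u" for u b
  proof -
    have "\<exists>u\<in>M. {b} \<inter> S u \<noteq> {}" using that by blast
    then obtain w where w: "own {b} = Some w" unfolding own_def by simp
    have "w = u" using own_Some[OF w] that M unfolding good_def by blast
    with w show ?thesis by simp
  qed
  define l where "l x = (if x \<in> nbs E r then None else Some r)" for x
  define m where "m x = own (if x \<in> A then S x else {x})" for x
  define X where "X a = S a - {b. \<exists>c. m a = Some c \<and> m b = Some c}" for a
  have mB: "m b = Some u \<longleftrightarrow> u \<in> M \<and> b \<in> S u" if "b \<in> B" for b u
  proof -
    have "b \<notin> A" using dis that by blast
    then show ?thesis using own_Some[of "{b}" u] own_point[of u b] by (auto simp: m_def)
  qed
  show ?thesis
  proof (rule that[of l m X])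
    show "range l \<subseteq> insert None (Some ` A)" using r by (auto simp: l_def)
    show "range m \<subseteq> insert None (Some ` A)"
    proof
      fix y assume "y \<in> range m"
      then show "y \<in> insert None (Some ` A)"
        using own_Some MA unfolding m_def by (cases y) blast+
    qed
    have lA: "l a = Some r" if "a \<in> A" for a
      using nB[OF r] dis that unfolding l_def by auto
    have nl: "nbs (blocks l E) a = nbs E a - nbs E r" if "a \<in> A" for a
      using lA[OF that] by (auto simp: blocks_edge l_def)
    show "nearly_disjoint_or_twins q A (blocks l E)"
      unfolding nearly_disjoint_or_twins_def
    proof (intro ballI)
      fix a a' assume a: "a \<in> A" "a' \<in> A"
      have "nbs (blocks l E) a \<inter> nbs (blocks l E) a' = nbs E a \<inter> nbs E a' - nbs E r"
        using nl a by blast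
      then show "nbs (blocks l E) a = nbs (blocks l E) a' \<or>
          card (nbs (blocks l E) a \<inter> nbs (blocks l E) a') < q"
        using twins_outside[OF a r] nl a by (metis not_le)
    qed
    show "nearly_disjoint_or_twins q A (blocks m E)"
      unfolding nearly_disjoint_or_twins_def
    proof (intro ballI)
      fix a a' assume a: "a \<in> A" "a' \<in> A"
      let ?N = "nbs (blocks m E)"
      show "?N a = ?N a' \<or> card (?N a \<inter> ?N a') < q"
      proof (rule ccontr)
        assume neg: "\<not> ?thesis"
        then have "?N a \<inter> ?N a' \<noteq> {}" using q by auto
        then obtain b where "b \<in> ?N a" "b \<in> ?N a'" by blast
        then obtain u where b: "{a, b} \<in> E" "m b = Some u" and u: "m a = Some u" "m a' = Some u"
          by (auto simp: blocks_edge)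
        have bB: "b \<in> B" using nB[OF a(1)] b(1) by auto
        have uM: "u \<in> M" using mB[OF bB] b(2) by blast
        have nm: "?N v = nbs E v \<inter> S u" if v: "v \<in> A" "m v = Some u" for v
          using nB[OF v(1)] mB uM v(2) by (auto simp: blocks_edge)
        have "?N a \<inter> ?N a' \<subseteq> nbs E a \<inter> nbs E a' - nbs E u"
          using nm a u by (auto simp: S_def)
        then have "card (?N a \<inter> ?N a') \<le> card (nbs E a \<inter> nbs E a' - nbs E u)"
          using nfin[OF a(1)] by (intro card_mono) auto
        then have "nbs E a - nbs E u = nbs E a' - nbs E u"
          using neg uM MA a by (intro twins_outside) auto
        then have "?N a = ?N a'" using nm a u by (auto simp: S_def)
        then show False using neg by blast
      qed
    qed
    show "\<forall>a\<in>A. X a \<subseteq> B \<and> card (X a) < q"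
    proof (intro ballI conjI)
      fix a assume a: "a \<in> A"
      show "X a \<subseteq> B" using SB by (auto simp: X_def)
      show "card (X a) < q"
      proof (cases "q \<le> card (S a)")
        case False
        then show ?thesis
          using card_mono[OF Sfin[of a], of "X a"] by (auto simp: X_def)
      next
        case True
        then obtain u where u: "m a = Some u"
          using covers[OF a] a by (auto simp: m_def own_def)
        have uM: "u \<in> M" "S a \<inter> S u \<noteq> {}" using own_Some u a by (auto simp: m_def)
        have "X a \<subseteq> S a - S u" using u uM(1) mB SB by (auto simp: X_def)
        then have "card (X a) \<le> card (S a - S u)" using Sfin by (intro card_mono) auto
        also have "\<dots> < q" using meet[of u a] uM MA a by blast
        finally show ?thesis .
      qed
    qed
    show "\<forall>a\<in>A. \<forall>b\<in>B. \<not> (\<exists>c. l a = Some c \<and> l b = Some c) \<longrightarrow>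
       \<not> (\<exists>c. m a = Some c \<and> m b = Some c) \<longrightarrow> ({a, b} \<in> E \<longleftrightarrow> b \<notin> X a)"
    proof (intro ballI impI)
      fix a b assume ab: "a \<in> A" "b \<in> B" "\<not> (\<exists>c. l a = Some c \<and> l b = Some c)"
        "\<not> (\<exists>c. m a = Some c \<and> m b = Some c)"
      have "b \<in> nbs E r" using ab(3) lA[OF ab(1)] by (auto simp: l_def split: if_splits)
      then show "{a, b} \<in> E \<longleftrightarrow> b \<notin> X a" using ab(4) by (auto simp: X_def S_def)
    qed
  qed
qed

section \<open>Graphs with few common neighbours and no long hole\<close>

definition induced_path :: "'a set set \<Rightarrow> 'a list \<Rightarrow> bool" where
  "induced_path E P \<longleftrightarrow> distinct P \<and>
     (\<forall>i<length P. \<forall>j<length P. {P ! i, P ! j} \<in> E \<longleftrightarrow> j = Suc i \<or> i = Suc j)"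

lemma induced_path_ConsI:
  assumes P: "induced_path E P" "P \<noteq> []" and y: "y \<notin> set P" "{y} \<notin> E"
    and adj: "\<And>j. j < length P \<Longrightarrow> {y, P ! j} \<in> E \<longleftrightarrow> j = 0"
  shows "induced_path E (y # P)"
  unfolding induced_path_def
proof (intro conjI allI impI)
  show "distinct (y # P)" using P y by (simp add: induced_path_def)
  fix i j assume ij: "i < length (y # P)" "j < length (y # P)"
  have adj': "{P ! j, y} \<in> E \<longleftrightarrow> j = 0" if "j < length P" for j
    using adj[OF that] by (simp add: insert_commute)
  have P': "{P ! i, P ! j} \<in> E \<longleftrightarrow> j = Suc i \<or> i = Suc j" if "i < length P" "j < length P" for i j
    using P(1) that by (simp add: induced_path_def)
  show "{(y # P) ! i, (y # P) ! j} \<in> E \<longleftrightarrow> j = Suc i \<or> i = Suc j"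
    using ij y(2) adj adj' P' by (cases i; cases j) auto
qed

lemma hole_ConsI:
  assumes P: "induced_path E P" and y: "y \<notin> set P" "{y} \<notin> E"
    and j: "0 < j" "j < length P"
    and adj: "\<And>i. i \<le> j \<Longrightarrow> {y, P ! i} \<in> E \<longleftrightarrow> i = 0 \<or> i = j"
  shows "hole E (y # take (Suc j) P)"
proof -
  let ?xs = "y # take (Suc j) P"
  have len: "length ?xs = j + 2" using j by simp
  have dist: "distinct ?xs" using P y in_set_takeD[of y "Suc j" P] by (auto simp: induced_path_def)
  have adj': "{P ! i, y} \<in> E \<longleftrightarrow> i = 0 \<or> i = j" if "i \<le> j" for i
    using adj[OF that] by (simp add: insert_commute)
  have P': "{P ! i, P ! i'} \<in> E \<longleftrightarrow> i' = Suc i \<or> i = Suc i'" if "i \<le> j" "i' \<le> j" for i i'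
    using P that j by (simp add: induced_path_def)
  have md: "Suc i mod (j + 2) = (if i = Suc j then 0 else Suc i)" if "i < j + 2" for i
    using that by auto
  have "{?xs ! i, ?xs ! i'} \<in> E \<longleftrightarrow> i' = Suc i mod (j + 2) \<or> i = Suc i' mod (j + 2)"
    if "i < j + 2" "i' < j + 2" for i i'
    unfolding md[OF that(1)] md[OF that(2)]
    using that y(2) adj adj' P' j by (cases i; cases i') auto
  then show ?thesis unfolding hole_def using dist len j by simp
qed

text \<open>
  The vertex of low degree is the first vertex of a longest induced path. Its neighbours are the next
  vertex of the path, which accounts for the successor, and the common neighbours with those among
  the first \<open>k\<close> vertices of the path that lie in the same part.
\<close>

lemma low_degree_or_twins:
  fixes A B :: "'a set"
  assumes fin: "finite A" "finite B" and dis: "A \<inter> B = {}" and ne: "A \<union> B \<noteq> {}"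
    and E: "E \<subseteq> between A B" and sA: "nearly_disjoint_or_twins q A E"
    and sB: "nearly_disjoint_or_twins q B E" and holes: "holes_at_most k E"
  shows "\<exists>x\<in>A \<union> B. card (nbs E x) \<le> Suc (k * q) \<or> (\<exists>y\<in>A \<union> B. y \<noteq> x \<and> nbs E x = nbs E y)"
proof -
  have loop: "{x} \<notin> E" for x using edge_between[of x x, OF _ E] dis by auto
  define paths where "paths = {P. induced_path E P \<and> P \<noteq> [] \<and> set P \<subseteq> A \<union> B}"
  have "finite paths"
    by (rule finite_subset[OF _ finite_subset_distinct[of "A \<union> B"]])
      (auto simp: paths_def induced_path_def fin)
  obtain v where "v \<in> A \<union> B" using ne by auto
  then have "[v] \<in> paths" by (auto simp: paths_def induced_path_def loop)
  then have "Max (length ` paths) \<in> length ` paths"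
    using \<open>finite paths\<close> by (intro Max_in) auto
  then obtain P where P: "P \<in> paths" and "length P = Max (length ` paths)" by auto
  then have longest: "length Q \<le> length P" if "Q \<in> paths" for Q
    using that \<open>finite paths\<close> by simp
  have ip: "induced_path E P" and Pne: "P \<noteq> []" and PV: "set P \<subseteq> A \<union> B"
    using P by (auto simp: paths_def)
  define x where "x = P ! 0"
  have xV: "x \<in> A \<union> B" using PV Pne unfolding x_def by (metis length_greater_0_conv nth_mem subsetD)
  show ?thesis
  proof (cases "\<exists>y\<in>A \<union> B. y \<noteq> x \<and> nbs E x = nbs E y")
    case True
    then show ?thesis using xV by blast
  next
    case False
    define J where "J = {j. j < k \<and> j < length P \<and> card (nbs E x \<inter> nbs E (P ! j)) < q}"
    have "nbs E x \<subseteq> insert (P ! 1) (\<Union>j\<in>J. nbs E x \<inter> nbs E (P ! j))"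
    proof
      fix y assume "y \<in> nbs E x"
      then have xy: "{x, y} \<in> E" "{y, x} \<in> E" by (auto simp: insert_commute)
      show "y \<in> insert (P ! 1) (\<Union>j\<in>J. nbs E x \<inter> nbs E (P ! j))"
      proof (cases "y \<in> set P")
        case True
        then obtain i where "i < length P" "y = P ! i" by (auto simp: in_set_conv_nth)
        then have "i = 1" using ip xy(1) Pne by (auto simp: induced_path_def x_def)
        then show ?thesis using \<open>y = P ! i\<close> by simp
      next
        case False
        have "\<exists>j. 0 < j \<and> j < length P \<and> {y, P ! j} \<in> E"
        proof (rule ccontr)
          assume "\<not> ?thesis"
          then have "induced_path E (y # P)"
            using ip Pne False loop xy by (intro induced_path_ConsI) (auto simp: x_def)
          moreover have "y \<in> A \<union> B" using edge_between[OF xy(1) E] by auto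
          ultimately have "y # P \<in> paths" using PV by (auto simp: paths_def)
          then show False using longest[of "y # P"] by simp
        qed
        then have ex: "\<exists>j. 0 < j \<and> j < length P \<and> {y, P ! j} \<in> E" .
        define j where "j = (LEAST j. 0 < j \<and> j < length P \<and> {y, P ! j} \<in> E)"
        have j: "0 < j" "j < length P" "{y, P ! j} \<in> E"
          using LeastI_ex[OF ex] by (auto simp: j_def)
        have first: "{y, P ! i} \<notin> E" if "0 < i" "i < j" for i
          using not_less_Least[of i "\<lambda>j. 0 < j \<and> j < length P \<and> {y, P ! j} \<in> E"] that j(2)
          by (auto simp: j_def[symmetric])
        have "{y, P ! i} \<in> E \<longleftrightarrow> i = 0 \<or> i = j" if "i \<le> j" for i
          using that first[of i] j(3) xy(2) unfolding x_def by (metis le_neq_implies_less not_gr_zero)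
        then have "hole E (y # take (Suc j) P)"
          using hole_ConsI[OF ip False loop j(1,2)] by blast
        then have "length (y # take (Suc j) P) \<le> k"
          using holes unfolding holes_at_most_def by blast
        then have jk: "j < k" using j(2) by simp
        have ne: "P ! j \<noteq> x"
          using ip j(1,2) Pne by (auto simp: induced_path_def x_def nth_eq_iff_index_eq)
        \<comment> \<open>Both are adjacent to \<open>y\<close>; in particular \<open>j\<close> is not \<open>1\<close>.\<close>
        have "x \<in> A \<and> P ! j \<in> A \<or> x \<in> B \<and> P ! j \<in> B"
          using edge_between[OF xy(2) E] edge_between[OF j(3) E] dis by auto
        then have "nbs E x = nbs E (P ! j) \<or> card (nbs E x \<inter> nbs E (P ! j)) < q"
          using sA sB unfolding nearly_disjoint_or_twins_def by blast
        moreover have "P ! j \<in> A \<union> B" using PV j(2) by (meson nth_mem subsetD)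
        ultimately have "j \<in> J"
          using \<open>\<not> (\<exists>y\<in>A \<union> B. y \<noteq> x \<and> nbs E x = nbs E y)\<close> ne jk j(2) by (auto simp: J_def)
        moreover have "y \<in> nbs E x \<inter> nbs E (P ! j)" using xy(1) j(3) by (auto simp: insert_commute)
        ultimately show ?thesis by blast
      qed
    qed
    moreover have finJ: "finite J" by (simp add: J_def)
    moreover have "finite (insert (P ! 1) (\<Union>j\<in>J. nbs E x \<inter> nbs E (P ! j)))"
      using finJ finite_nbs[OF E fin] by blast
    ultimately have "card (nbs E x) \<le> card (insert (P ! 1) (\<Union>j\<in>J. nbs E x \<inter> nbs E (P ! j)))"
      by (intro card_mono)
    also have "\<dots> \<le> Suc (card (\<Union>j\<in>J. nbs E x \<inter> nbs E (P ! j)))"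
      by (rule card_insert_le_m1) auto
    also have "card (\<Union>j\<in>J. nbs E x \<inter> nbs E (P ! j)) \<le> (\<Sum>j\<in>J. card (nbs E x \<inter> nbs E (P ! j)))"
      using finJ by (rule card_UN_le)
    also have "\<dots> \<le> card J * q"
      using sum_bounded_above[of J "\<lambda>j. card (nbs E x \<inter> nbs E (P ! j))" q] by (auto simp: J_def)
    also have "card J \<le> k"
      using card_mono[of "{..<k}" J] by (auto simp: J_def)
    finally have "card (nbs E x) \<le> Suc (k * q)" by simp
    then show ?thesis using xV by blast
  qed
qed


section \<open>Counting\<close>

definition small_subsets :: "nat \<Rightarrow> 'a set \<Rightarrow> 'a set set" where
  "small_subsets d V = {T. T \<subseteq> V \<and> card T \<le> d}"

lemma finite_small_subsets: "finite V \<Longrightarrow> finite (small_subsets d V)"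
  by (rule finite_subset[of _ "Pow V"]) (auto simp: small_subsets_def)

lemma card_small_subsets:
  assumes "finite V"
  shows "card (small_subsets d V) \<le> Suc (card V) ^ d"
proof (induction d)
  case 0
  have "small_subsets 0 V = {{}}"
    using assms finite_subset by (fastforce simp: small_subsets_def)
  then show ?case by simp
next
  case (Suc d)
  let ?D = "insert None (Some ` V) \<times> small_subsets d V"
  let ?f = "\<lambda>(z, T). case z of None \<Rightarrow> T | Some x \<Rightarrow> insert x T"
  have "small_subsets (Suc d) V \<subseteq> ?f ` ?D"
  proof
    fix T assume T: "T \<in> small_subsets (Suc d) V"
    then have fT: "finite T" using assms finite_subset by (auto simp: small_subsets_def)
    show "T \<in> ?f ` ?D"
    proof (cases "T = {}")
      case True
      then have "(None, T) \<in> ?D" by (simp add: small_subsets_def)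
      then show ?thesis by force
    next
      case False
      then obtain x where x: "x \<in> T" by auto
      then have "(Some x, T - {x}) \<in> ?D" using T fT by (auto simp: small_subsets_def)
      moreover have "T = ?f (Some x, T - {x})" using x by auto
      ultimately show ?thesis by (rule rev_image_eqI)
    qed
  qed
  moreover have finD: "finite ?D" using assms by (simp add: finite_small_subsets)
  ultimately have "card (small_subsets (Suc d) V) \<le> card ?D"
    using surj_card_le by blast
  also have "\<dots> = Suc (card V) * card (small_subsets d V)"
    using assms by (simp add: card_cartesian_product card_insert_if card_image)
  also have "\<dots> \<le> Suc (card V) ^ Suc d" unfolding power_Suc by (rule mult_le_mono2[OF Suc.IH])
  finally show ?case .
qed

definition two_sided :: "nat \<Rightarrow> nat \<Rightarrow> 'a set \<Rightarrow> 'a set \<Rightarrow> 'a set set set" where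
  "two_sided q k A B = {E. E \<subseteq> between A B \<and> nearly_disjoint_or_twins q A E \<and>
     nearly_disjoint_or_twins q B E \<and> holes_at_most k E}"

lemma finite_edge_sets:
  assumes "finite A" "finite B"
  shows "finite {E. E \<subseteq> between A B \<and> P E}"
proof (rule finite_subset)
  show "{E. E \<subseteq> between A B \<and> P E} \<subseteq> Pow (Pow (A \<union> B))" by (auto simp: between_def)
qed (use assms in simp)

lemma blocks_two_sided:
  assumes E: "E \<subseteq> between A B" and sA: "nearly_disjoint_or_twins q A E"
    and sB: "nearly_disjoint_or_twins q B E" and holes: "holes_at_most k E"
    and q: "0 < q" and fin: "finite A" "finite B"
  shows "nearly_disjoint_or_twins q A (blocks l E)" "nearly_disjoint_or_twins q B (blocks l E)"
    "holes_at_most k (blocks l E)"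
proof -
  show "nearly_disjoint_or_twins q A (blocks l E)" "nearly_disjoint_or_twins q B (blocks l E)"
    using nearly_disjoint_or_twins_blocks q sA sB finite_nbs[OF E fin] by blast+
  show "holes_at_most k (blocks l E)" using holes_at_most_blocks[OF holes] .
qed

text \<open>
  A graph is recovered from the graph without \<open>x\<close> and from \<open>N(x)\<close>, which is either a set of bounded
  size or the neighbourhood of another vertex. With \<open>d\<close> the bound on the degree, this leaves at most
  \<open>K * (K ^ d + K)\<close> possibilities for each removed vertex.
\<close>

lemma card_two_sided:
  fixes A B :: "'a set"
  assumes "finite A" "finite B" "A \<inter> B = {}" "0 < q" "card (A \<union> B) + 2 \<le> K"
  shows "card (two_sided q k A B) \<le> K ^ ((k * q + 3) * card (A \<union> B))"
  using assms
proof (induction "card (A \<union> B)" arbitrary: A B)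
  case 0
  then have "A = {}" "B = {}" by auto
  then have "two_sided q k A B \<subseteq> {{}}" by (auto simp: two_sided_def between_def)
  then have "card (two_sided q k A B) \<le> card {{} :: 'a set set}" by (intro card_mono) auto
  then show ?case using 0 by simp
next
  case (Suc m)
  let ?d = "Suc (k * q)" and ?V = "A \<union> B"
  let ?C = "\<lambda>x. two_sided q k (A - {x}) (B - {x})"
  let ?T = "\<lambda>E'. small_subsets ?d ?V \<union> nbs E' ` ?V"
  let ?f = "\<lambda>x E' T. E' \<union> (\<lambda>t. {x, t}) ` T"
  have finV: "finite ?V" using Suc.prems by simp
  have K: "Suc (card ?V) \<le> K" "card ?V \<le> K" "2 \<le> K" using Suc.prems by auto
  have finC: "finite (?C x)" for x
    unfolding two_sided_def by (rule finite_edge_sets) (use Suc.prems in auto)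
  have finT: "finite (?T E')" for E' using finV finite_small_subsets by blast
  have "two_sided q k A B \<subseteq> (\<Union>x\<in>?V. \<Union>E'\<in>?C x. ?f x E' ` ?T E')"
  proof
    fix E assume "E \<in> two_sided q k A B"
    then have E: "E \<subseteq> between A B" and sA: "nearly_disjoint_or_twins q A E"
      and sB: "nearly_disjoint_or_twins q B E" and holes: "holes_at_most k E"
      by (auto simp: two_sided_def)
    have "?V \<noteq> {}" using Suc.hyps(2) by auto
    then obtain x where x: "x \<in> ?V"
      and low: "card (nbs E x) \<le> ?d \<or> (\<exists>y\<in>?V. y \<noteq> x \<and> nbs E x = nbs E y)"
      using low_degree_or_twins[OF Suc.prems(1-3) _ E sA sB holes] by blast
    have loop: "{x} \<notin> E" using edge_between[of x x, OF _ E] Suc.prems(3) by auto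
    \<comment> \<open>Deleting \<open>x\<close> is an instance of \<^const>\<open>blocks\<close>, so the class is inherited.\<close>
    define E' where "E' = blocks (\<lambda>y. if y = x then None else Some ()) E"
    have E'_eq: "E' = {e \<in> E. x \<notin> e}" by (auto simp: E'_def blocks_def)
    have "E' \<in> ?C x"
      unfolding two_sided_def
    proof (intro CollectI conjI)
      show "E' \<subseteq> between (A - {x}) (B - {x})"
      proof
        fix e assume "e \<in> E'"
        then have "e \<in> between A B" "x \<notin> e" using E by (auto simp: E'_eq)
        then obtain a b where "e = {a, b}" "a \<in> A - {x}" "b \<in> B - {x}" by (auto simp: between_def)
        then show "e \<in> between (A - {x}) (B - {x})" unfolding between_def by blast
      qed
      note inherit = blocks_two_sided[OF E sA sB holes Suc.prems(4,1,2)]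
      show "nearly_disjoint_or_twins q (A - {x}) E'" "nearly_disjoint_or_twins q (B - {x}) E'"
        using inherit(1,2) unfolding nearly_disjoint_or_twins_def E'_def by blast+
      show "holes_at_most k E'" unfolding E'_def by (rule inherit(3))
    qed
    moreover have "nbs E x \<in> ?T E'"
    proof (cases "card (nbs E x) \<le> ?d")
      case True
      have "nbs E x \<subseteq> ?V" using edge_between[OF _ E] by (metis UnI1 UnI2 mem_nbs subsetI)
      then show ?thesis using True by (auto simp: small_subsets_def)
    next
      case False
      then obtain y where y: "y \<in> ?V" "y \<noteq> x" "nbs E x = nbs E y" using low by blast
      have "nbs E' y = nbs E y - {x}" using y(2) by (auto simp: E'_eq)
      also have "\<dots> = nbs E x - {x}" using y(3) by simp
      also have "\<dots> = nbs E x" using loop by auto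
      finally show ?thesis using y(1) by blast
    qed
    moreover have "E = ?f x E' (nbs E x)"
    proof
      show "E \<subseteq> ?f x E' (nbs E x)"
      proof
        fix e assume e: "e \<in> E"
        show "e \<in> ?f x E' (nbs E x)"
        proof (cases "x \<in> e")
          case True
          then obtain t where "e = {x, t}" using e E by (auto simp: between_def)
          then show ?thesis using e by auto
        qed (use e E'_eq in auto)
      qed
    qed (auto simp: E'_eq)
    ultimately show "E \<in> (\<Union>x\<in>?V. \<Union>E'\<in>?C x. ?f x E' ` ?T E')" using x by blast
  qed
  then have "card (two_sided q k A B) \<le> card (\<Union>x\<in>?V. \<Union>E'\<in>?C x. ?f x E' ` ?T E')"
    using finV finC finT by (intro card_mono) auto
  also have "\<dots> \<le> (\<Sum>x\<in>?V. card (\<Union>E'\<in>?C x. ?f x E' ` ?T E'))"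
    using finV by (rule card_UN_le)
  also have "\<dots> \<le> (\<Sum>x\<in>?V. K ^ ((k * q + 3) * m) * (K * K ^ ?d))"
  proof (rule sum_mono)
    fix x assume x: "x \<in> ?V"
    have V': "(A - {x}) \<union> (B - {x}) = ?V - {x}" by auto
    have m: "card ((A - {x}) \<union> (B - {x})) = m" unfolding V' using x finV Suc.hyps(2) by simp
    have C: "card (?C x) \<le> K ^ ((k * q + 3) * m)"
    proof -
      have "(A - {x}) \<inter> (B - {x}) = {}" using Suc.prems(3) by blast
      moreover have "m + 2 \<le> K" using Suc.prems(5) Suc.hyps(2) by simp
      ultimately show ?thesis
        using Suc.hyps(1)[of "A - {x}" "B - {x}"] m Suc.prems(1,2,4) by simp
    qed
    have "card (\<Union>E'\<in>?C x. ?f x E' ` ?T E') \<le> (\<Sum>E'\<in>?C x. card (?f x E' ` ?T E'))"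
      using finC by (rule card_UN_le)
    also have "\<dots> \<le> (\<Sum>E'\<in>?C x. K * K ^ ?d)"
    proof (rule sum_mono)
      fix E'
      have "card (?f x E' ` ?T E') \<le> card (?T E')" using finT by (rule card_image_le)
      also have "\<dots> \<le> card (small_subsets ?d ?V) + card (nbs E' ` ?V)" by (rule card_Un_le)
      also have "\<dots> \<le> K ^ ?d + K"
      proof (rule add_mono)
        show "card (small_subsets ?d ?V) \<le> K ^ ?d"
          using card_small_subsets[OF finV, of ?d] power_mono[OF K(1), of ?d] by simp
        show "card (nbs E' ` ?V) \<le> K" using card_image_le[OF finV, of "nbs E'"] K(2) by simp
      qed
      also have "\<dots> \<le> 2 * K ^ ?d" using K(3) self_le_power[of K ?d] by simp
      also have "\<dots> \<le> K * K ^ ?d" using K(3) by simp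
      finally show "card (?f x E' ` ?T E') \<le> K * K ^ ?d" .
    qed
    also have "\<dots> = card (?C x) * (K * K ^ ?d)" by simp
    also have "\<dots> \<le> K ^ ((k * q + 3) * m) * (K * K ^ ?d)" using C by (rule mult_right_mono) simp
    finally show "card (\<Union>E'\<in>?C x. ?f x E' ` ?T E') \<le> K ^ ((k * q + 3) * m) * (K * K ^ ?d)" .
  qed
  also have "\<dots> = card ?V * (K ^ ((k * q + 3) * m) * (K * K ^ ?d))" by simp
  also have "\<dots> \<le> K * (K ^ ((k * q + 3) * m) * (K * K ^ ?d))"
    using K(2) by (rule mult_right_mono) simp
  also have "\<dots> = K ^ ((k * q + 3) * m + ?d + 2)" by (simp add: power_add power2_eq_square mult_ac)
  also have "(k * q + 3) * m + ?d + 2 = (k * q + 3) * Suc m" by simp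
  finally show ?case using Suc.hyps(2) by simp
qed

definition triple_class :: "nat \<Rightarrow> nat \<Rightarrow> 'a set \<Rightarrow> 'a set \<Rightarrow> 'a set set set" where
  "triple_class q k A B = {E. E \<subseteq> between A B \<and> triple_condition q A E \<and>
     triple_condition q B E \<and> holes_at_most k E}"

text \<open>
  The triple condition does not pass to disjoint unions, so the decomposition for \<open>B\<close> cannot be
  applied to the pieces obtained for \<open>A\<close>. Instead both decompositions are taken of the whole graph,
  and only pairs joined in both of them remain to be described. The two labellings for \<open>A\<close> and the
  two for \<open>B\<close> cut these pairs into four pieces, each of which inherits the property of both.
\<close>

lemma card_triple_class:
  fixes A B :: "'a set"
  assumes fin: "finite A" "finite B" and dis: "A \<inter> B = {}" and q: "0 < q"
    and K: "card (A \<union> B) + 2 \<le> K"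
  shows "card (triple_class q k A B) \<le> K ^ ((4 * (k * q + 3) + q + 4) * card (A \<union> B))"
proof -
  define V where "V = A \<union> B"
  define n where "n = card V"
  have finV: "finite V" using fin by (simp add: V_def)
  define Lab where "Lab = (V \<rightarrow>\<^sub>E insert None (Some ` V))"
  define Exc where "Exc = (V \<rightarrow>\<^sub>E small_subsets q V)"
  define TS where "TS = two_sided q k A B"
  have finite_parts: "finite Lab" "finite Exc" "finite TS"
    unfolding Lab_def Exc_def TS_def two_sided_def
    using finV finite_small_subsets fin by (auto intro!: finite_PiE finite_edge_sets)
  have cLab: "card Lab \<le> K ^ n"
  proof -
    have "card Lab = Suc n ^ n"
      using finV by (simp add: Lab_def card_PiE card_insert_if card_image n_def)
    then show ?thesis using K power_mono[of "Suc n" K n] by (simp add: n_def V_def)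
  qed
  have cExc: "card Exc \<le> K ^ (q * n)"
  proof -
    have "card (small_subsets q V) \<le> K ^ q"
      using card_small_subsets[OF finV, of q] power_mono[of "Suc n" K q] K by (simp add: n_def V_def)
    then have "card (small_subsets q V) ^ n \<le> (K ^ q) ^ n" by (rule power_mono) simp
    then show ?thesis using finV by (simp add: Exc_def card_PiE n_def power_mult)
  qed
  have cTS: "card TS \<le> K ^ ((k * q + 3) * n)"
    using card_two_sided[OF fin dis q K] by (simp add: TS_def n_def V_def)
  define cov :: "('a \<Rightarrow> 'a option) \<Rightarrow> 'a \<Rightarrow> 'a \<Rightarrow> bool"
    where "cov l a b \<longleftrightarrow> (\<exists>c. l a = Some c \<and> l b = Some c)" for l a b
  define dec where "dec = (\<lambda>(l, m, l', m', X, F1, F2, F3, F4).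
     {{a, b} | a b. a \<in> A \<and> b \<in> B \<and>
       (if cov l a b \<or> cov m a b
        then if cov l' a b \<or> cov m' a b then {a, b} \<in> F1 \<union> F2 \<union> F3 \<union> F4 else a \<notin> X b
        else b \<notin> X a)})"
  let ?D = "Lab \<times> Lab \<times> Lab \<times> Lab \<times> Exc \<times> TS \<times> TS \<times> TS \<times> TS"
  have "triple_class q k A B \<subseteq> dec ` ?D"
  proof
    fix E assume "E \<in> triple_class q k A B"
    then have E: "E \<subseteq> between A B" and tA: "triple_condition q A E"
      and tB: "triple_condition q B E" and holes: "holes_at_most k E"
      by (auto simp: triple_class_def)
    obtain l m X where lm: "range l \<subseteq> insert None (Some ` A)" "range m \<subseteq> insert None (Some ` A)"
      "nearly_disjoint_or_twins q A (blocks l E)" "nearly_disjoint_or_twins q A (blocks m E)"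
      and X: "\<forall>a\<in>A. X a \<subseteq> B \<and> card (X a) < q"
      and decA: "\<forall>a\<in>A. \<forall>b\<in>B. \<not> cov l a b \<longrightarrow> \<not> cov m a b \<longrightarrow> ({a, b} \<in> E \<longleftrightarrow> b \<notin> X a)"
      by (rule triple_condition_decomposition[OF fin dis E tA q, folded cov_def])
    have E': "E \<subseteq> between B A" and dis': "B \<inter> A = {}"
      using E dis by (auto simp: between_commute)
    obtain l' m' X' where lm': "range l' \<subseteq> insert None (Some ` B)" "range m' \<subseteq> insert None (Some ` B)"
      "nearly_disjoint_or_twins q B (blocks l' E)" "nearly_disjoint_or_twins q B (blocks m' E)"
      and X': "\<forall>b\<in>B. X' b \<subseteq> A \<and> card (X' b) < q"
      and decB: "\<forall>b\<in>B. \<forall>a\<in>A. \<not> cov l' b a \<longrightarrow> \<not> cov m' b a \<longrightarrow> ({b, a} \<in> E \<longleftrightarrow> a \<notin> X' b)"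
      by (rule triple_condition_decomposition[OF fin(2,1) dis' E' tB q, folded cov_def])
    have finN: "finite (nbs (blocks f E) x)" for f :: "'a \<Rightarrow> 'a option" and x
      using finite_nbs[OF subset_trans[OF blocks_subset E] fin] .
    have piece: "blocks g (blocks f E) \<in> TS"
      if "nearly_disjoint_or_twins q A (blocks f E)" "nearly_disjoint_or_twins q B (blocks g E)"
      for f g :: "'a \<Rightarrow> 'a option"
    proof -
      have "nearly_disjoint_or_twins q A (blocks g (blocks f E))"
        using nearly_disjoint_or_twins_blocks[OF that(1) q finN] .
      moreover have "nearly_disjoint_or_twins q B (blocks g (blocks f E))"
        unfolding blocks_commute[of g f]
        using nearly_disjoint_or_twins_blocks[OF that(2) q finN] .
      moreover have "blocks g (blocks f E) \<subseteq> between A B"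
        using E blocks_subset by (metis subset_trans)
      ultimately show ?thesis
        unfolding TS_def two_sided_def using holes holes_at_most_blocks by blast
    qed
    \<comment> \<open>One function stores the exceptions of both decompositions.\<close>
    define Y where "Y x = (if x \<in> A then X x else X' x)" for x
    let ?r = "\<lambda>f. restrict f V"
    let ?code = "(?r l, ?r m, ?r l', ?r m', ?r Y, blocks l' (blocks l E), blocks m' (blocks l E),
       blocks l' (blocks m E), blocks m' (blocks m E))"
    have lab: "?r f \<in> Lab" if "range f \<subseteq> insert None (Some ` A) \<or> range f \<subseteq> insert None (Some ` B)" for f
    proof -
      have "range f \<subseteq> insert None (Some ` V)" using that by (auto simp: V_def)
      then show ?thesis unfolding Lab_def by auto
    qed
    have "Y x \<in> small_subsets q V" if "x \<in> V" for x
    proof (cases "x \<in> A")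
      case True
      then have "Y x \<subseteq> B" "card (Y x) < q" using X by (auto simp: Y_def)
      then show ?thesis by (auto simp: small_subsets_def V_def)
    next
      case False
      then have "Y x \<subseteq> A" "card (Y x) < q" using X' that by (auto simp: Y_def V_def)
      then show ?thesis by (auto simp: small_subsets_def V_def)
    qed
    then have "?r Y \<in> Exc" by (simp add: Exc_def)
    then have code: "?code \<in> ?D" using lab lm lm' piece by simp
    have cov_r: "cov (?r f) a b \<longleftrightarrow> cov f a b" if "a \<in> A" "b \<in> B" for f a b
      using that by (simp add: cov_def V_def)
    have edge: "{a, b} \<in> E \<longleftrightarrow> (if cov l a b \<or> cov m a b
        then if cov l' a b \<or> cov m' a b then {a, b} \<in> blocks l' (blocks l E) \<union> blocks m' (blocks l E) \<union>
          blocks l' (blocks m E) \<union> blocks m' (blocks m E) else a \<notin> Y b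
        else b \<notin> Y a)" if ab: "a \<in> A" "b \<in> B" for a b
    proof -
      have "b \<notin> A" using ab dis by blast
      then have Y: "Y a = X a" "Y b = X' b" using ab by (auto simp: Y_def)
      have "{a, b} \<in> E \<longleftrightarrow> a \<notin> X' b" if "\<not> cov l' a b" "\<not> cov m' a b"
      proof -
        have "\<not> cov l' b a" "\<not> cov m' b a" using that by (auto simp: cov_def)
        then have "{b, a} \<in> E \<longleftrightarrow> a \<notin> X' b" using decB ab by blast
        then show ?thesis by (simp add: insert_commute)
      qed
      moreover have "{a, b} \<in> blocks g (blocks f E) \<longleftrightarrow> {a, b} \<in> E \<and> cov f a b \<and> cov g a b"
        for f g :: "'a \<Rightarrow> 'a option"
        by (auto simp: blocks_edge cov_def)
      ultimately show ?thesis using decA ab Y by auto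
    qed
    have "E = {{a, b} | a b. a \<in> A \<and> b \<in> B \<and> {a, b} \<in> E}"
      using E unfolding between_def by blast
    also have "\<dots> = dec ?code"
    proof -
      have rA: "?r Y a = Y a" if "a \<in> A" for a using that by (simp add: V_def)
      have rB: "?r Y b = Y b" if "b \<in> B" for b using that by (simp add: V_def)
      show ?thesis
        by (simp add: dec_def edge cov_r rA rB del: restrict_apply cong: conj_cong)
    qed
    finally show "E \<in> dec ` ?D" using code by (rule image_eqI)
  qed
  then have "card (triple_class q k A B) \<le> card ?D"
    using finite_parts by (intro surj_card_le) auto
  also have "\<dots> = card Lab ^ 4 * card Exc * card TS ^ 4"
    by (simp add: card_cartesian_product power4_eq_xxxx)
  also have "\<dots> \<le> (K ^ n) ^ 4 * K ^ (q * n) * (K ^ ((k * q + 3) * n)) ^ 4"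
    using cLab cExc cTS by (intro mult_mono power_mono) auto
  also have "\<dots> = K ^ ((4 * (k * q + 3) + q + 4) * n)"
  proof -
    have "(4 * (k * q + 3) + q + 4) * n = n * 4 + q * n + ((k * q + 3) * n) * 4"
      by (simp add: algebra_simps)
    then show ?thesis by (simp only: power_add power_mult)
  qed
  finally show ?thesis by (simp add: n_def V_def)
qed

section \<open>Graphs without the forbidden subgraph\<close>

lemma parts_N: "left (N p) = {0, 1, p + 3}" "right (N p) = {2..<p + 3}"
  by (auto simp: N_def L1_def complete_bipartite_def)

lemma edges_N: "edges (N p) = insert {0, p + 2} (between {0, 1} {2..<p + 2})"
proof -
  have "{0..<2::nat} = {0, 1}" by auto
  then show ?thesis by (simp add: N_def L1_def complete_bipartite_def between_def add.commute)
qed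

lemma adj_N:
  assumes "x \<in> {0, 1, p + 3}" "y \<in> {2..<p + 3}"
  shows "adj (N p) x y \<longleftrightarrow> x = 0 \<or> x = 1 \<and> y \<noteq> p + 2"
proof -
  have "{x, y} \<in> between {0, 1} {2..<p + 2} \<longleftrightarrow> x \<in> {0, 1} \<and> y \<in> {2..<p + 2}"
    using assms by (auto simp: between_def doubleton_eq_iff)
  then show ?thesis using assms by (auto simp: adj_def edges_N doubleton_eq_iff)
qed

lemma adj_sides:
  assumes "bipartite_graph G" "adj G x y"
  shows "x \<in> left G \<and> y \<in> right G \<or> x \<in> right G \<and> y \<in> left G"
  using assms edge_between[of x y "edges G" "left G" "right G"]
  by (auto simp: bipartite_graph_def adj_def between_def)

lemma adj_commute: "adj G x y \<longleftrightarrow> adj G y x"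
  by (simp add: adj_def insert_commute)

lemma bipartite_N: "bipartite_graph (N p)"
proof -
  have "{0, p + 2} \<in> between {0, 1, p + 3} {2..<p + 3}"
    unfolding between_def by (rule CollectI, rule exI[of _ 0], rule exI[of _ "p + 2"]) simp
  moreover have "between {0, 1} {2..<p + 2} \<subseteq> between {0, 1, p + 3} {2..<p + 3}"
    unfolding between_def by (intro Collect_mono ex_mono) auto
  ultimately show ?thesis unfolding bipartite_graph_def parts_N edges_N between_def[symmetric] by auto
qed

text \<open>
  The vertices \<open>r\<close>, \<open>u\<close>, \<open>v\<close> become \<open>0\<close>, \<open>1\<close> and the isolated vertex \<open>p + 3\<close>, and \<open>x\<close> becomes the
  pendant vertex. The vertex \<open>v\<close> differs from \<open>r\<close> and \<open>u\<close> because the large set is nonempty, and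
  \<open>x\<close> distinguishes \<open>r\<close> from \<open>u\<close>.
\<close>

lemma contains_N_if_triple_condition_fails:
  assumes G: "bipartite_graph G"
    and AB: "A = left G \<and> B = right G \<or> A = right G \<and> B = left G"
    and ruv: "r \<in> A" "u \<in> A" "v \<in> A"
    and big: "p < card (nbs (edges G) r \<inter> nbs (edges G) u - nbs (edges G) v)"
    and x: "x \<in> nbs (edges G) r" "x \<notin> nbs (edges G) u" "x \<notin> nbs (edges G) v"
  shows "contains_induced G (N p)"
proof -
  let ?W = "nbs (edges G) r \<inter> nbs (edges G) u - nbs (edges G) v"
  have dis: "A \<inter> B = {}" and E: "edges G \<subseteq> between A B"
    using G AB between_commute[of A B] by (auto simp: bipartite_graph_def between_def[symmetric])
  obtain T where T: "T \<subseteq> ?W" "card T = p" "finite T"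
    using obtain_subset_with_card_n[of p ?W] big by auto
  obtain h where h: "bij_betw h {2..<p + 2} T"
    using finite_same_card_bij[of "{2..<p + 2}" T] T by auto
  have "?W \<noteq> {}" using big by (metis card.empty not_less_zero)
  then have ne: "r \<noteq> u" "r \<noteq> v" "u \<noteq> v" using x by auto
  define f where "f i = (if i = 0 then r else if i = 1 then u else if i = p + 3 then v
      else if i = p + 2 then x else h i)" for i
  have hT: "h i \<in> T" if "2 \<le> i" "i < p + 2" for i using h that by (auto simp: bij_betw_def)
  have TB: "T \<subseteq> B" using T(1) nbs_subset[OF E dis ruv(1)] by blast
  have xB: "x \<in> B" using x(1) nbs_subset[OF E dis ruv(1)] by blast
  have xT: "x \<notin> T" using T(1) x by auto
  have fl: "f ` left (N p) \<subseteq> A" using ruv by (auto simp: parts_N f_def)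
  have fr: "f ` right (N p) \<subseteq> B" using hT TB xB by (auto simp: parts_N f_def)
  have injl: "inj_on f (left (N p))" using ne by (auto simp: inj_on_def parts_N f_def)
  have injr: "inj_on f (right (N p))"
  proof -
    have "f i \<in> T \<longleftrightarrow> i \<noteq> p + 2" "i \<noteq> p + 2 \<Longrightarrow> f i = h i" if "i \<in> {2..<p + 3}" for i
      using that hT xT by (auto simp: f_def)
    moreover have "inj_on h {2..<p + 2}" using h by (auto simp: bij_betw_def)
    ultimately show ?thesis unfolding inj_on_def parts_N
      by (metis atLeastLessThan_iff nat_less_le less_Suc_eq add_2_eq_Suc' add_Suc_right eval_nat_numeral(3))
  qed
  have inj: "inj_on f (verts (N p))"
    unfolding verts_def using injl injr fl fr dis by (auto simp: inj_on_Un)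
  have cross: "adj G (f i) (f j) \<longleftrightarrow> adj (N p) i j" if "i \<in> left (N p)" "j \<in> right (N p)" for i j
  proof -
    have j: "j = p + 2 \<and> f j = x \<or> j \<noteq> p + 2 \<and> f j \<in> T"
      using that(2) hT by (auto simp: parts_N f_def)
    have "i = 0 \<and> f i = r \<or> i = 1 \<and> f i = u \<or> i = p + 3 \<and> f i = v"
      using that(1) by (auto simp: parts_N f_def)
    then show ?thesis
      using that adj_N[of i p j] j x T(1) by (auto simp: parts_N adj_def)
  qed
  have "adj G (f i) (f j) \<longleftrightarrow> adj (N p) i j" if ij: "i \<in> verts (N p)" "j \<in> verts (N p)" for i j
  proof -
    have same: "\<not> adj G (f i) (f j) \<and> \<not> adj (N p) i j"
      if "i \<in> left (N p) \<and> j \<in> left (N p) \<or> i \<in> right (N p) \<and> j \<in> right (N p)"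
    proof
      have "f i \<in> A \<and> f j \<in> A \<or> f i \<in> B \<and> f j \<in> B" using that fl fr by blast
      then show "\<not> adj G (f i) (f j)"
        using edge_between[of "f i" "f j", OF _ E] dis by (auto simp: adj_def)
      have "left (N p) \<inter> right (N p) = {}" using bipartite_N by (simp add: bipartite_graph_def)
      then show "\<not> adj (N p) i j" using adj_sides[OF bipartite_N, of p i j] that by blast
    qed
    show ?thesis
      using ij same cross[of i j] cross[of j i] unfolding verts_def
      by (auto simp: adj_commute)
  qed
  then show ?thesis
    unfolding contains_induced_def using inj fl fr AB by blast
qed

lemma free_triple_class:
  assumes G: "bipartite_graph G" and free: "\<not> contains_induced G (N p)"
    and chord: "chordality_at_most k G"
  shows "edges G \<in> triple_class (Suc p) k (left G) (right G)"
proof -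
  have E: "edges G \<subseteq> between (left G) (right G)" using G by (simp add: bipartite_graph_def between_def)
  have trip: "triple_condition (Suc p) A (edges G)" if side: "A = left G \<or> A = right G" for A
    unfolding triple_condition_def
  proof (intro ballI impI subsetI)
    fix r u v x assume *: "r \<in> A" "u \<in> A" "v \<in> A"
      "Suc p \<le> card (nbs (edges G) r \<inter> nbs (edges G) u - nbs (edges G) v)"
      "x \<in> nbs (edges G) r - nbs (edges G) u"
    obtain B where B: "A = left G \<and> B = right G \<or> A = right G \<and> B = left G" using side by blast
    show "x \<in> nbs (edges G) v"
      using contains_N_if_triple_condition_fails[OF G B *(1-3), of p x] *(4,5) free by auto
  qed
  have "length xs \<le> k" if h: "hole (edges G) xs" for xs
  proof (rule ccontr)
    assume long: "\<not> length xs \<le> k"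
    let ?n = "length xs"
    have n: "3 \<le> ?n" "distinct xs"
      and adj: "\<And>i j. i < ?n \<Longrightarrow> j < ?n \<Longrightarrow> adj G (xs ! i) (xs ! j) \<longleftrightarrow>
        j = Suc i mod ?n \<or> i = Suc j mod ?n"
      using h unfolding hole_def adj_def by auto
    have step: "adj G (xs ! i) (xs ! (Suc i mod ?n))" if "i < ?n" for i
      using adj[of i "Suc i mod ?n"] that by (metis gr_implies_not0 mod_less_divisor not_gr0)
    have "set xs \<subseteq> verts G"
      using adj_sides[OF G step] unfolding verts_def by (metis UnI1 UnI2 in_set_conv_nth subsetI)
    then have "is_cycle G xs" unfolding is_cycle_def using n step by blast
    moreover have "chordless G xs" unfolding chordless_def using adj by blast
    ultimately show False using chord long unfolding chordality_at_most_def by auto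
  qed
  then show ?thesis using E trip by (auto simp: triple_class_def holes_at_most_def)
qed

section \<open>The class is hereditary and at most factorial\<close>

lemma contains_induced_trans:
  assumes "contains_induced G H" "contains_induced H F"
  shows "contains_induced G F"
proof -
  obtain f where f: "inj_on f (verts H)" "\<forall>x\<in>verts H. \<forall>y\<in>verts H. adj G (f x) (f y) \<longleftrightarrow> adj H x y"
    "f ` left H \<subseteq> left G \<and> f ` right H \<subseteq> right G \<or> f ` left H \<subseteq> right G \<and> f ` right H \<subseteq> left G"
    using assms(1) unfolding contains_induced_def by blast
  obtain g where g: "inj_on g (verts F)" "\<forall>x\<in>verts F. \<forall>y\<in>verts F. adj H (g x) (g y) \<longleftrightarrow> adj F x y"
    "g ` left F \<subseteq> left H \<and> g ` right F \<subseteq> right H \<or> g ` left F \<subseteq> right H \<and> g ` right F \<subseteq> left H"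
    using assms(2) unfolding contains_induced_def by blast
  have gv: "g ` verts F \<subseteq> verts H" using g(3) unfolding verts_def by blast
  have "inj_on (f \<circ> g) (verts F)" using g(1) gv f(1) by (meson comp_inj_on inj_on_subset)
  moreover have "\<forall>x\<in>verts F. \<forall>y\<in>verts F. adj G ((f \<circ> g) x) ((f \<circ> g) y) \<longleftrightarrow> adj F x y"
    using f(2) g(2) gv by (simp add: image_subset_iff)
  moreover have "(f \<circ> g) ` left F \<subseteq> left G \<and> (f \<circ> g) ` right F \<subseteq> right G \<or>
      (f \<circ> g) ` left F \<subseteq> right G \<and> (f \<circ> g) ` right F \<subseteq> left G"
    using f(3) g(3) unfolding image_comp[symmetric] by (meson image_mono subset_trans)
  ultimately show ?thesis unfolding contains_induced_def by blast
qed

lemma chordality_induced: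
  assumes "contains_induced G H" "chordality_at_most k G"
  shows "chordality_at_most k H"
  unfolding chordality_at_most_def
proof
  assume "\<exists>xs. is_cycle H xs \<and> chordless H xs \<and> k < length xs"
  then obtain xs where xs: "is_cycle H xs" "chordless H xs" "k < length xs" by blast
  obtain f where f: "inj_on f (verts H)" "\<forall>x\<in>verts H. \<forall>y\<in>verts H. adj G (f x) (f y) \<longleftrightarrow> adj H x y"
    "f ` left H \<subseteq> left G \<and> f ` right H \<subseteq> right G \<or> f ` left H \<subseteq> right G \<and> f ` right H \<subseteq> left G"
    using assms(1) unfolding contains_induced_def by blast
  have fv: "f ` verts H \<subseteq> verts G" using f(3) unfolding verts_def by blast
  have V: "set xs \<subseteq> verts H" and n: "3 \<le> length xs" "distinct xs" using xs(1) by (auto simp: is_cycle_def)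
  have adj: "adj G (map f xs ! i) (map f xs ! j) \<longleftrightarrow> adj H (xs ! i) (xs ! j)"
    if "i < length xs" "j < length xs" for i j
    using that f(2) V nth_mem[OF that(1)] nth_mem[OF that(2)] by (simp add: subset_iff)
  have lt: "Suc i mod length xs < length xs" for i using n by (intro mod_less_divisor) auto
  have "is_cycle G (map f xs)"
    unfolding is_cycle_def
  proof (intro conjI allI impI)
    show "distinct (map f xs)" using n(2) f(1) V by (auto simp: distinct_map intro: inj_on_subset)
    show "set (map f xs) \<subseteq> verts G" using V fv by auto
    show "3 \<le> length (map f xs)" using n by simp
    fix i assume "i < length (map f xs)"
    then show "adj G (map f xs ! i) (map f xs ! (Suc i mod length (map f xs)))"
      using adj[of i "Suc i mod length xs"] lt xs(1) by (simp add: is_cycle_def)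
  qed
  moreover have "chordless G (map f xs)"
    using xs(2) adj by (simp add: chordless_def)
  ultimately show False using assms(2) xs(3) unfolding chordality_at_most_def by auto
qed

theorem theorem8:
  fixes k p :: nat
  shows "at_most_factorial
    {G :: nat bigraph. bipartite_graph G \<and> \<not> contains_induced G (N p) \<and> chordality_at_most k G}"
proof -
  let ?X = "{G :: nat bigraph. bipartite_graph G \<and> \<not> contains_induced G (N p) \<and> chordality_at_most k G}"
  define c where "c = 4 * (k * Suc p + 3) + Suc p + 4"
  have her: "hereditary ?X"
    unfolding hereditary_def using contains_induced_trans chordality_induced by blast
  have count: "card (labelled ?X n) \<le> (n + 2) ^ ((c + 2) * n)" for n
  proof -
    let ?P = "{(A, B). A \<union> B = {1..n} \<and> A \<inter> B = {}}"
    let ?C = "\<lambda>(A, B). (\<lambda>E. \<lparr>left = A, right = B, edges = E\<rparr> :: nat bigraph) `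
        triple_class (Suc p) k A B"
    have PP: "?P \<subseteq> Pow {1..n} \<times> Pow {1..n}" by auto
    then have finP: "finite ?P" by (rule finite_subset) simp
    have "card ?P \<le> card (Pow {1..n} \<times> Pow {1..n})" by (rule card_mono[OF _ PP]) simp
    also have "\<dots> = 2 ^ n * 2 ^ n" by (simp add: card_cartesian_product card_Pow)
    also have "\<dots> \<le> (n + 2) ^ n * (n + 2) ^ n" by (intro mult_mono power_mono) auto
    finally have cP: "card ?P \<le> (n + 2) ^ (2 * n)" by (simp add: mult_2 power_add)
    have fin: "finite A" "finite B" if "(A, B) \<in> ?P" for A B
      using that finite_subset[of A "{1..n}"] finite_subset[of B "{1..n}"] by auto
    have finC: "finite (?C AB)" if "AB \<in> ?P" for AB
      using fin that by (cases AB) (auto simp: triple_class_def intro!: finite_edge_sets finite_imageI)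
    have cC: "card (?C AB) \<le> (n + 2) ^ (c * n)" if "AB \<in> ?P" for AB
    proof -
      obtain A B where AB: "AB = (A, B)" by (cases AB)
      have V: "A \<union> B = {1..n}" "A \<inter> B = {}" and f: "finite A" "finite B"
        using that fin[of A B] AB by auto
      have T: "card (triple_class (Suc p) k A B) \<le> (n + 2) ^ (c * n)"
        using card_triple_class[OF f V(2), of "Suc p" "n + 2" k] V by (simp add: c_def)
      have "finite (triple_class (Suc p) k A B)"
        unfolding triple_class_def using f by (rule finite_edge_sets)
      then have "card (?C AB) \<le> card (triple_class (Suc p) k A B)"
        unfolding AB by (simp add: card_image_le)
      then show ?thesis using T by simp
    qed
    have "labelled ?X n \<subseteq> (\<Union>AB\<in>?P. ?C AB)"
    proof
      fix G assume "G \<in> labelled ?X n"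
      then have G: "bipartite_graph G" "\<not> contains_induced G (N p)" "chordality_at_most k G"
        "verts G = {1..n}" by (auto simp: labelled_def)
      have "(left G, right G) \<in> ?P" using G(1,4) by (auto simp: bipartite_graph_def verts_def)
      moreover have "G \<in> ?C (left G, right G)"
        using free_triple_class[OF G(1-3)] by (auto intro!: image_eqI[of _ _ "edges G"])
      ultimately show "G \<in> (\<Union>AB\<in>?P. ?C AB)" by blast
    qed
    then have "card (labelled ?X n) \<le> card (\<Union>AB\<in>?P. ?C AB)"
      using finP finC by (intro card_mono) auto
    also have "\<dots> \<le> (\<Sum>AB\<in>?P. card (?C AB))" using finP by (rule card_UN_le)
    also have "\<dots> \<le> card ?P * (n + 2) ^ (c * n)"
      using sum_bounded_above[of ?P "\<lambda>AB. card (?C AB)" "(n + 2) ^ (c * n)"] cC by simp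
    also have "\<dots> \<le> (n + 2) ^ (2 * n) * (n + 2) ^ (c * n)" using cP by (rule mult_right_mono) simp
    also have "\<dots> = (n + 2) ^ ((c + 2) * n)"
      by (simp only: power_add[symmetric] add_mult_distrib add.commute)
    finally show ?thesis .
  qed
  define f where "f n = real (c + 2) * (real n * log 2 (real n + 2))" for n :: nat
  have "(\<lambda>n::nat. real n * log 2 (real n + 2)) \<in> O(\<lambda>n. real n * ln (real n))"
    by real_asymp
  then have "f \<in> O(\<lambda>n. real n * ln (real n))" unfolding f_def by simp
  moreover have "real (card (labelled ?X n)) \<le> 2 powr f n" for n
  proof -
    have "real (card (labelled ?X n)) \<le> real ((n + 2) ^ ((c + 2) * n))"
      using count[of n] by (simp only: of_nat_le_iff)
    also have "\<dots> = (real n + 2) powr real ((c + 2) * n)"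
      by (subst powr_realpow) (auto simp: add.commute)
    also have "\<dots> = (2 powr log 2 (real n + 2)) powr real ((c + 2) * n)" by simp
    also have "\<dots> = 2 powr f n" unfolding powr_powr f_def by (simp only: of_nat_mult mult_ac)
    finally show ?thesis .
  qed
  ultimately show ?thesis unfolding at_most_factorial_def using her by blast
qed

end
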